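(* Let $V$ be a finite set, let $U$ be a universe of set separations of $V$ with order function $|(A,B)|:=|A\cap B|$, let $k$ be an integer, and let $P$ be a regular $k$-profile in $U$. Then there exists a function $w\colon V\to\mathbb{N}$ such that for every separation $(A,B)\in U$ of order $<k$ we have $(A,B)\in P$ if and only if $w(A)<w(B)$, where $w(X):=\sum_{x\in X}w(x)$ for $X\subseteq V$.
   Context: A set separation of a set $V$ is an ordered pair $(A,B)$ of subsets of $V$ with $A\cup B=V$; its inverse is $(B,A)$, and its order is $|A\cap B|$. Set separations are partially ordered by $(A,B)\le(C,D)$ iff $A\subseteq C$ and $B\supseteq D$; the join of $(A,B)$ and $(C,D)$ is $(A\cup C,B\cap D)$ and their meet is $(A\cap C,B\cup D)$. A universe of set separations of $V$ is a set $U$ of set separations of $V$ closed under taking inverses, joins and meets. For an integer $k$, let $S_k$ be the set of separations in $U$ of order $<k$. A $k$-profile in $U$ is a set $P\subseteq S_k$ containing exactly one of $(A,B)$ and $(B,A)$ for every $(A,B)\in S_k$, such that (consistency) whenever $(C,D)\in P$ and $(A,B)\in S_k$ with $(A,B)\le(C,D)$ and $(A,B)\neq(D,C)$, then $(A,B)\in P$; and (profile property) whenever $(A,B),(C,D)\in P$ and $(A\cup C,B\cap D)$ has order $<k$, then $(B\cap D,A\cup C)\notin P$. A separation $(A,B)$ is small if $(A,B)\le(B,A)$ (i.e. $B=V$) and co-small if $(B,A)$ is small (i.e. $A=V$). A profile is regular if it contains no co-small separation. *)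

theory Defs
  imports Main
begin

type_synonym 'a sep = "'a set \<times> 'a set"

definition set_separation :: "'a set \<Rightarrow> 'a sep \<Rightarrow> bool" where
  "set_separation V = (\<lambda>(A, B). A \<subseteq> V \<and> B \<subseteq> V \<and> A \<union> B = V)"

fun sep_inverse :: "'a sep \<Rightarrow> 'a sep" where
  "sep_inverse (A, B) = (B, A)"

fun sep_order :: "'a sep \<Rightarrow> nat" where
  "sep_order (A, B) = card (A \<inter> B)"

fun sep_le :: "'a sep \<Rightarrow> 'a sep \<Rightarrow> bool" where
  "sep_le (A, B) (C, D) \<longleftrightarrow> A \<subseteq> C \<and> D \<subseteq> B"

fun sep_join :: "'a sep \<Rightarrow> 'a sep \<Rightarrow> 'a sep" where
  "sep_join (A, B) (C, D) = (A \<union> C, B \<inter> D)"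

fun sep_meet :: "'a sep \<Rightarrow> 'a sep \<Rightarrow> 'a sep" where
  "sep_meet (A, B) (C, D) = (A \<inter> C, B \<union> D)"

definition universe :: "'a set \<Rightarrow> 'a sep set \<Rightarrow> bool" where
  "universe V U \<longleftrightarrow>
     (\<forall>s\<in>U. set_separation V s) \<and>
     (\<forall>s\<in>U. sep_inverse s \<in> U) \<and>
     (\<forall>r\<in>U. \<forall>s\<in>U. sep_join r s \<in> U) \<and>
     (\<forall>r\<in>U. \<forall>s\<in>U. sep_meet r s \<in> U)"

definition seps_below :: "'a sep set \<Rightarrow> int \<Rightarrow> 'a sep set" where
  "seps_below U k = {s \<in> U. int (sep_order s) < k}"

(* The unique existence in the second conjunct counts elements of the set
   {s, sep_inverse s}, so the self-inverse separation (V, V) does not make the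
   condition contradictory by itself. *)
definition profile :: "'a sep set \<Rightarrow> int \<Rightarrow> 'a sep set \<Rightarrow> bool" where
  "profile U k P \<longleftrightarrow>
     P \<subseteq> seps_below U k \<and>
     (\<forall>s\<in>seps_below U k. \<exists>!r. r \<in> {s, sep_inverse s} \<and> r \<in> P) \<and>
     (\<forall>s\<in>P. \<forall>r\<in>seps_below U k. sep_le r s \<and> r \<noteq> sep_inverse s \<longrightarrow> r \<in> P) \<and>
     (\<forall>r\<in>P. \<forall>s\<in>P. int (sep_order (sep_join r s)) < k \<longrightarrow> sep_inverse (sep_join r s) \<notin> P)"

definition small :: "'a sep \<Rightarrow> bool" where
  "small s \<longleftrightarrow> sep_le s (sep_inverse s)"

definition cosmall :: "'a sep \<Rightarrow> bool" where
  "cosmall s \<longleftrightarrow> small (sep_inverse s)"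

definition regular :: "'a sep set \<Rightarrow> bool" where
  "regular P \<longleftrightarrow> (\<forall>s\<in>P. \<not> cosmall s)"

end

theory Submission
  imports Defs Complex_Main
begin

text \<open>
  Let \<open>M\<close> be the set of maximal elements of \<open>P\<close>; it suffices to find weights with
  \<open>w A < w B\<close> for all \<open>(A, B) \<in> M\<close>. For distinct \<open>(A, B), (C, D) \<in> M\<close> the profile property
  and maximality force the join to have order at least \<open>k\<close>, so by submodularity the join has
  larger order than the meet. With \<open>S = A \<inter> B\<close> and \<open>T = C \<inter> D\<close> this says
  \<open>(|S \<inter> D| - |S \<inter> C|) + (|T \<inter> B| - |T \<inter> A|) > 0\<close>. If no weights exist, linear duality yields
  coefficients \<open>y \<ge> 0\<close> on \<open>M\<close>, not all zero, such that \<open>\<Sum> y\<^sub>s (1\<^sub>B - 1\<^sub>A) \<le> 0\<close> pointwise, the sum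
  being over \<open>s = (A, B) \<in> M\<close>. Summing this over the separators with weights \<open>y\<close> and symmetrising
  leaves only one nonzero coefficient, whence some \<open>(A, B) \<in> P\<close> has \<open>B \<subseteq> A\<close>, contradicting
  regularity.
\<close>

section \<open>A theorem of the alternative\<close>

text \<open>Supplies the value of the eliminated variable in Fourier--Motzkin elimination, with
  \<open>L\<close> and \<open>H\<close> as its lower and upper bounds. Density covers the case of
  two nonempty sets, unboundedness of the order the others.\<close>

lemma finite_sets_separated_by_element:
  fixes L H :: "'b::linordered_field set"
  assumes "finite L" "finite H" "\<And>l h. l \<in> L \<Longrightarrow> h \<in> H \<Longrightarrow> l < h"
  shows "\<exists>t. (\<forall>l\<in>L. l < t) \<and> (\<forall>h\<in>H. t < h)"
proof (cases "L = {} \<or> H = {}")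
  case True
  moreover have "\<exists>t. \<forall>l\<in>L. l < t"
    using assms(1) by (cases "L = {}") (auto simp flip: Max_less_iff intro: gt_ex)
  moreover have "\<exists>t. \<forall>h\<in>H. t < h"
    using assms(2) by (cases "H = {}") (auto simp flip: Min_gr_iff intro: lt_ex)
  ultimately show ?thesis by auto
next
  case False
  then have "Max L < Min H" using assms by auto
  then obtain t where "Max L < t" "t < Min H" using dense by blast
  then show ?thesis using False assms(1,2) by auto
qed

text \<open>
  Ville's theorem, by Fourier--Motzkin elimination. The set \<open>C\<close> stands for the convex cone spanned
  by \<open>F\<close>; keeping it abstract allows the induction hypothesis to be applied to the elements of
  \<open>C\<close> that are nonpositive at the eliminated coordinate.
\<close>

lemma positive_weights_or_nonpositive_combination:
  fixes F C :: "('a \<Rightarrow> 'b::linordered_field) set"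
  assumes "finite V" "finite F" "F \<subseteq> C"
    and "\<And>f g. f \<in> C \<Longrightarrow> g \<in> C \<Longrightarrow> (\<lambda>v. f v + g v) \<in> C"
    and "\<And>c f. 0 < c \<Longrightarrow> f \<in> C \<Longrightarrow> (\<lambda>v. c * f v) \<in> C"
  shows "(\<exists>w. (\<forall>v\<in>V. 0 \<le> w v) \<and> (\<forall>f\<in>F. 0 < (\<Sum>v\<in>V. w v * f v)))
       \<or> (\<exists>g\<in>C. \<forall>v\<in>V. g v \<le> 0)"
  using assms
proof (induction V arbitrary: F C)
  case empty
  then show ?case by (cases "F = {}") auto
next
  case (insert a V)
  define Pos where "Pos = {f \<in> F. 0 < f a}"
  define Neg where "Neg = {f \<in> F. f a < 0}"
  \<comment> \<open>Both multipliers \<open>- n a\<close> and \<open>p a\<close> are positive, and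
    they cancel the coordinate \<open>a\<close>.\<close>
  define elim :: "('a \<Rightarrow> 'b) \<times> ('a \<Rightarrow> 'b) \<Rightarrow> 'a \<Rightarrow> 'b"
    where "elim = (\<lambda>(p, n) v. - n a * p v + p a * n v)"
  \<comment> \<open>Functions negative at \<open>a\<close> are kept too: they must be positive
    before \<open>a\<close> gets any weight, which leaves room for a positive weight at
    \<open>a\<close>.\<close>
  define F' where "F' = {f \<in> F. f a \<le> 0} \<union> elim ` (Pos \<times> Neg)"
  \<comment> \<open>A member of \<open>C'\<close> that is nonpositive on \<open>V\<close> is
    nonpositive on \<open>insert a V\<close>, so the second alternative carries over
    directly.\<close>
  define C' where "C' = {g \<in> C. g a \<le> 0}"
  have fin: "finite Pos" "finite Neg" using insert.prems(1) by (auto simp: Pos_def Neg_def)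
  have elim_C': "elim (p, n) \<in> C'" if "p \<in> Pos" "n \<in> Neg" for p n
  proof -
    have "p \<in> C" "n \<in> C" "0 < p a" "0 < - n a"
      using that insert.prems(2) by (auto simp: Pos_def Neg_def)
    then have "(\<lambda>v. - n a * p v + p a * n v) \<in> C"
      using insert.prems(3)[OF insert.prems(4)[of "- n a" p] insert.prems(4)[of "p a" n]] by simp
    then show ?thesis by (simp add: C'_def elim_def)
  qed
  have "(\<exists>w. (\<forall>v\<in>V. 0 \<le> w v) \<and> (\<forall>f\<in>F'. 0 < (\<Sum>v\<in>V. w v * f v)))
      \<or> (\<exists>g\<in>C'. \<forall>v\<in>V. g v \<le> 0)"
  proof (rule insert.IH)
    show "finite F'" using insert.prems(1) fin by (simp add: F'_def)
    show "F' \<subseteq> C'" using elim_C' insert.prems(2) by (auto simp: F'_def C'_def)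
    show "(\<lambda>v. f v + g v) \<in> C'" if "f \<in> C'" "g \<in> C'" for f g
      using that insert.prems(3) by (auto simp: C'_def add_nonpos_nonpos)
    show "(\<lambda>v. c * f v) \<in> C'" if "0 < c" "f \<in> C'" for c f
      using that insert.prems(4) by (auto simp: C'_def mult_nonneg_nonpos)
  qed
  then show ?case
  proof
    assume "\<exists>g\<in>C'. \<forall>v\<in>V. g v \<le> 0"
    then show ?thesis by (auto simp: C'_def)
  next
    assume "\<exists>w. (\<forall>v\<in>V. 0 \<le> w v) \<and> (\<forall>f\<in>F'. 0 < (\<Sum>v\<in>V. w v * f v))"
    then obtain w where w: "\<forall>v\<in>V. 0 \<le> w v" and pos: "\<forall>f\<in>F'. 0 < (\<Sum>v\<in>V. w v * f v)"
      by blast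
    define e where "e f = (\<Sum>v\<in>V. w v * f v)" for f
    have e_elim: "0 < - n a * e p + p a * e n" if "p \<in> Pos" "n \<in> Neg" for p n
    proof -
      have "elim (p, n) \<in> F'" using that by (auto simp: F'_def)
      then have "0 < (\<Sum>v\<in>V. w v * elim (p, n) v)" using pos by blast
      also have "\<dots> = (\<Sum>v\<in>V. - n a * (w v * p v) + p a * (w v * n v))"
        by (rule sum.cong) (auto simp: elim_def algebra_simps)
      also have "\<dots> = - n a * e p + p a * e n"
        unfolding e_def sum.distrib sum_distrib_left ..
      finally show ?thesis .
    qed
    have e_nonpos: "0 < e f" if "f \<in> F" "f a \<le> 0" for f
      using that pos by (auto simp: F'_def e_def)
    \<comment> \<open>With weight \<open>t\<close> at \<open>a\<close>, the condition for
      \<open>f\<close> reads \<open>0 < t * f a + e f\<close>. Solving for \<open>t\<close> gives a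
      lower bound for \<open>f\<close> in \<open>Pos\<close> and an upper bound for \<open>f\<close>
      in \<open>Neg\<close>; the extra \<open>0\<close> makes \<open>t\<close> positive.\<close>
    let ?L = "insert 0 ((\<lambda>p. - e p / p a) ` Pos)"
    let ?H = "(\<lambda>n. e n / - n a) ` Neg"
    have "\<exists>t. (\<forall>l\<in>?L. l < t) \<and> (\<forall>h\<in>?H. t < h)"
    proof (rule finite_sets_separated_by_element)
      show "finite ?L" "finite ?H" using fin by auto
      show "l < h" if "l \<in> ?L" "h \<in> ?H" for l h
      proof -
        obtain n where n: "n \<in> Neg" "h = e n / - n a" using \<open>h \<in> ?H\<close> by blast
        have na: "n a < 0" "0 < e n" using n e_nonpos by (auto simp: Neg_def)
        consider "l = 0" | p where "p \<in> Pos" "l = - e p / p a" using \<open>l \<in> ?L\<close> by blast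
        then show ?thesis
        proof cases
          case 1
          then show ?thesis using na n by (simp add: divide_pos_neg)
        next
          case 2
          then have "0 < p a" by (simp add: Pos_def)
          then have "- e p / p a < e n / - n a"
            using na e_elim[OF 2(1) n(1)]
            by (simp add: field_simps)
          then show ?thesis using 2 n by simp
        qed
      qed
    qed
    then obtain t where t: "0 < t" "\<And>p. p \<in> Pos \<Longrightarrow> - e p / p a < t"
      "\<And>n. n \<in> Neg \<Longrightarrow> t < e n / - n a" by auto
    have "0 < (\<Sum>v\<in>insert a V. (w(a := t)) v * f v)" if "f \<in> F" for f
    proof -
      have "(\<Sum>v\<in>V. (w(a := t)) v * f v) = e f"
        unfolding e_def using insert.hyps(2) by (intro sum.cong) auto
      then have eq: "(\<Sum>v\<in>insert a V. (w(a := t)) v * f v) = t * f a + e f"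
        using insert.hyps by simp
      consider "0 < f a" | "f a = 0" | "f a < 0" by force
      then have "0 < t * f a + e f"
      proof cases
        case 1
        then have "- e f < t * f a"
          using t(2)[of f] that pos_divide_less_eq[of "f a" "- e f" t] by (simp add: Pos_def)
        then show ?thesis by simp
      next
        case 2
        then show ?thesis using e_nonpos[OF that] by simp
      next
        case 3
        then have "t * - f a < e f"
          using t(3)[of f] that pos_less_divide_eq[of "- f a" t "e f"] by (simp add: Neg_def)
        then show ?thesis by simp
      qed
      then show ?thesis using eq by simp
    qed
    moreover have "\<forall>v\<in>insert a V. 0 \<le> (w(a := t)) v" using w t(1) by auto
    ultimately show ?thesis by blast
  qed
qed

text \<open>Scaling by a common denominator preserves the signs of weighted sums; this turns
  rational weights into natural numbers.\<close>

lemma nonneg_rat_common_denominator: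
  fixes w :: "'a \<Rightarrow> rat"
  assumes "finite V" "\<forall>v\<in>V. 0 \<le> w v"
  shows "\<exists>(d::nat) u. 0 < d \<and> (\<forall>v\<in>V. of_nat d * w v = of_nat (u v))"
  using assms
proof (induction V)
  case empty
  then show ?case by (auto intro: exI[of _ 1])
next
  case (insert a V)
  then obtain d :: nat and u where d: "0 < d" "\<forall>v\<in>V. of_nat d * w v = of_nat (u v)" by auto
  obtain m n where q: "quotient_of (w a) = (m, n)" by fastforce
  have mn: "w a = of_int m / of_int n" "0 < n"
    using quotient_of_div[OF q] quotient_of_denom_pos[OF q] by auto
  have "0 \<le> m" using insert.prems mn by (simp add: zero_le_divide_iff)
  define u' where "u' = (\<lambda>v. nat n * u v)(a := d * nat m)"
  have "of_nat (d * nat n) * w v = of_nat (u' v)" if "v \<in> insert a V" for v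
  proof (cases "v = a")
    case True
    then show ?thesis using mn \<open>0 \<le> m\<close> by (simp add: u'_def)
  next
    case False
    then have "of_nat (d * nat n) * w v = of_nat (nat n) * (of_nat d * w v)"
      by (simp add: mult.assoc mult.left_commute)
    then show ?thesis using False that d(2) by (simp add: u'_def)
  qed
  moreover have "0 < d * nat n" using d mn by simp
  ultimately show ?case by blast
qed

lemma nat_weights_or_nonpositive_combination:
  fixes a :: "'i \<Rightarrow> 'a \<Rightarrow> int"
  assumes "finite V" "finite I"
  shows "(\<exists>w :: 'a \<Rightarrow> nat. \<forall>i\<in>I. 0 < (\<Sum>v\<in>V. int (w v) * a i v))
       \<or> (\<exists>y :: 'i \<Rightarrow> rat. (\<forall>i\<in>I. 0 \<le> y i) \<and> (\<exists>i\<in>I. 0 < y i)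
            \<and> (\<forall>v\<in>V. (\<Sum>i\<in>I. y i * of_int (a i v)) \<le> 0))"
proof -
  \<comment> \<open>Requiring a positive coefficient excludes the trivial combination, which would
    satisfy the second alternative for free.\<close>
  define C :: "('a \<Rightarrow> rat) set" where
    "C = {g. \<exists>y. (\<forall>i\<in>I. 0 \<le> y i) \<and> (\<exists>i\<in>I. 0 < y i) \<and> g = (\<lambda>v. \<Sum>i\<in>I. y i * of_int (a i v))}"
  define F :: "('a \<Rightarrow> rat) set" where "F = (\<lambda>i v. of_int (a i v)) ` I"
  have "(\<exists>w. (\<forall>v\<in>V. 0 \<le> w v) \<and> (\<forall>f\<in>F. 0 < (\<Sum>v\<in>V. w v * f v)))
      \<or> (\<exists>g\<in>C. \<forall>v\<in>V. g v \<le> 0)"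
  proof (rule positive_weights_or_nonpositive_combination[OF assms(1)])
    show "finite F" using assms(2) by (simp add: F_def)
    show "F \<subseteq> C"
    proof
      fix f assume "f \<in> F"
      then obtain i where i: "i \<in> I" "f = (\<lambda>v. of_int (a i v))" by (auto simp: F_def)
      have "f = (\<lambda>v. \<Sum>j\<in>I. (if j = i then 1 else 0) * of_int (a j v))"
        using i assms(2) by (simp add: if_distrib[of "\<lambda>x. x * _"] sum.delta cong: if_cong)
      then show "f \<in> C"
        using i(1) unfolding C_def by (intro CollectI exI[of _ "\<lambda>j. if j = i then 1 else 0"]) auto
    qed
    show "(\<lambda>v. f v + g v) \<in> C" if fg: "f \<in> C" "g \<in> C" for f g
    proof -
      obtain y z where y: "\<forall>i\<in>I. 0 \<le> y i" "\<exists>i\<in>I. 0 < y i" "f = (\<lambda>v. \<Sum>i\<in>I. y i * of_int (a i v))"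
        and z: "\<forall>i\<in>I. 0 \<le> z i" "g = (\<lambda>v. \<Sum>i\<in>I. z i * of_int (a i v))"
        using fg unfolding C_def by blast
      have "\<forall>i\<in>I. 0 \<le> y i + z i" "\<exists>i\<in>I. 0 < y i + z i"
        using y z by (auto intro: add_pos_nonneg)
      then show ?thesis
        unfolding C_def y(3) z(2)
        by (intro CollectI exI[of _ "\<lambda>i. y i + z i"]) (simp add: distrib_right sum.distrib)
    qed
    show "(\<lambda>v. c * f v) \<in> C" if c: "0 < c" "f \<in> C" for c f
    proof -
      obtain y where y: "\<forall>i\<in>I. 0 \<le> y i" "\<exists>i\<in>I. 0 < y i" "f = (\<lambda>v. \<Sum>i\<in>I. y i * of_int (a i v))"
        using c unfolding C_def by blast
      have "\<exists>i\<in>I. 0 < c * y i" using y(2) c(1) mult_pos_pos by blast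
      then show ?thesis
        unfolding C_def y(3) using y(1) c(1)
        by (intro CollectI exI[of _ "\<lambda>i. c * y i"]) (auto simp add: sum_distrib_left mult.assoc)
    qed
  qed
  then show ?thesis
  proof
    assume "\<exists>g\<in>C. \<forall>v\<in>V. g v \<le> 0"
    then show ?thesis unfolding C_def by blast
  next
    assume "\<exists>w. (\<forall>v\<in>V. 0 \<le> w v) \<and> (\<forall>f\<in>F. 0 < (\<Sum>v\<in>V. w v * f v))"
    then obtain w :: "'a \<Rightarrow> rat" where w: "\<forall>v\<in>V. 0 \<le> w v"
      and pos: "\<And>i. i \<in> I \<Longrightarrow> 0 < (\<Sum>v\<in>V. w v * of_int (a i v))"
      unfolding F_def by auto
    obtain d :: nat and u where d: "0 < d" "\<forall>v\<in>V. of_nat d * w v = of_nat (u v)"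
      using nonneg_rat_common_denominator[OF assms(1) w] by blast
    have "0 < (\<Sum>v\<in>V. int (u v) * a i v)" if "i \<in> I" for i
    proof -
      have "0 < of_nat d * (\<Sum>v\<in>V. w v * of_int (a i v))" using pos[OF that] d(1) by simp
      also have "\<dots> = (\<Sum>v\<in>V. of_nat (u v) * of_int (a i v))"
        using d(2) by (simp add: sum_distrib_left flip: mult.assoc)
      also have "\<dots> = of_int (\<Sum>v\<in>V. int (u v) * a i v)" by simp
      finally show ?thesis by (simp only: of_int_0_less_iff)
    qed
    then show ?thesis by blast
  qed
qed

section \<open>Separations\<close>

abbreviation separator :: "'a sep \<Rightarrow> 'a set" where
  "separator s \<equiv> fst s \<inter> snd s"

text \<open>For \<open>(A, B)\<close> this is the indicator of \<open>B\<close> minus that of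
  \<open>A\<close>, which makes \<open>w A < w B\<close> a linear condition on
  \<open>w\<close>.\<close>

definition side_diff :: "'a sep \<Rightarrow> 'a \<Rightarrow> int" where
  "side_diff s v = of_bool (v \<in> snd s) - of_bool (v \<in> fst s)"

lemma sum_side_diff:
  assumes "finite X"
  shows "(\<Sum>v\<in>X. w v * side_diff s v) = sum w (X \<inter> snd s) - sum w (X \<inter> fst s)"
  unfolding side_diff_def
  by (simp add: assms right_diff_distrib sum_subtractf of_bool_def if_distrib[of "\<lambda>x. _ * x"]
      sum.inter_restrict cong: if_cong)

lemma sum_side_diff_card:
  assumes "finite X"
  shows "(\<Sum>v\<in>X. side_diff s v) = int (card (X \<inter> snd s)) - int (card (X \<inter> fst s))"
  using sum_side_diff[OF assms, of "\<lambda>_. 1" s] by simp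

text \<open>With separators \<open>S\<close> and \<open>T\<close>, the join has separator
  \<open>(S \<inter> D) \<union> (T \<inter> B)\<close> and the meet
  \<open>(S \<inter> C) \<union> (T \<inter> A)\<close>. In both the two pieces overlap exactly in
  \<open>S \<inter> T\<close>, which cancels.\<close>

lemma sep_order_join_minus_meet:
  assumes "finite (separator r)" "finite (separator s)"
  shows "int (sep_order (sep_join r s)) - int (sep_order (sep_meet r s))
       = (\<Sum>v\<in>separator r. side_diff s v) + (\<Sum>v\<in>separator s. side_diff r v)"
proof -
  obtain A B C D where rs: "r = (A, B)" "s = (C, D)" by fastforce
  let ?S = "A \<inter> B" and ?T = "C \<inter> D"
  have fin: "finite ?S" "finite ?T" using assms rs by auto
  have "(A \<union> C) \<inter> (B \<inter> D) = (?S \<inter> D) \<union> (?T \<inter> B)" "(?S \<inter> D) \<inter> (?T \<inter> B) = ?S \<inter> ?T"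
    "(A \<inter> C) \<inter> (B \<union> D) = (?S \<inter> C) \<union> (?T \<inter> A)" "(?S \<inter> C) \<inter> (?T \<inter> A) = ?S \<inter> ?T"
    by auto
  then have "card (?S \<inter> D) + card (?T \<inter> B) = card ((A \<union> C) \<inter> (B \<inter> D)) + card (?S \<inter> ?T)"
    "card (?S \<inter> C) + card (?T \<inter> A) = card ((A \<inter> C) \<inter> (B \<union> D)) + card (?S \<inter> ?T)"
    using card_Un_Int[of "?S \<inter> D" "?T \<inter> B"] card_Un_Int[of "?S \<inter> C" "?T \<inter> A"] fin by auto
  then show ?thesis using fin by (simp add: rs sum_side_diff_card)
qed

text \<open>Submodularity, here with equality: since both separations cover \<open>V\<close>, the
  separators of join and meet have the same union and the same intersection as the two original
  separators.\<close>

lemma sep_order_join_plus_meet: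
  assumes "set_separation V r" "set_separation V s" "finite V"
  shows "sep_order (sep_join r s) + sep_order (sep_meet r s) = sep_order r + sep_order s"
proof -
  obtain A B C D where rs: "r = (A, B)" "s = (C, D)" by fastforce
  let ?J = "(A \<union> C) \<inter> (B \<inter> D)" and ?M = "(A \<inter> C) \<inter> (B \<union> D)"
  have V: "A \<union> B = V" "C \<union> D = V" using assms(1,2) rs by (auto simp: set_separation_def)
  then have "finite A" "finite B" "finite C" "finite D"
    using assms(3) finite_UnI finite_Un by metis+
  then have fin: "finite (A \<inter> B)" "finite (C \<inter> D)" and fin': "finite ?J" "finite ?M"
    by auto
  have "?J \<union> ?M = (A \<inter> B) \<union> (C \<inter> D)" "?J \<inter> ?M = (A \<inter> B) \<inter> (C \<inter> D)"
    using V by blast+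
  then have "card ?J + card ?M = card (A \<inter> B) + card (C \<inter> D)"
    using card_Un_Int[OF fin'] card_Un_Int[OF fin] by simp
  then show ?thesis by (simp add: rs)
qed

section \<open>Maximal elements of a regular profile\<close>

definition maximal_seps :: "'a sep set \<Rightarrow> 'a sep set" where
  "maximal_seps P = {s \<in> P. \<forall>r\<in>P. sep_le s r \<longrightarrow> r = s}"

lemma sep_le_trans: "sep_le r s \<Longrightarrow> sep_le s t \<Longrightarrow> sep_le r t"
  by (cases r; cases s; cases t) auto

lemma sep_le_antisym: "sep_le r s \<Longrightarrow> sep_le s r \<Longrightarrow> r = s"
  by (cases r; cases s) auto

lemma sep_le_join: "sep_le r (sep_join r s)" "sep_le s (sep_join r s)"
  by (cases r; cases s; auto)+

lemma below_maximal_sep: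
  assumes "finite P" "s \<in> P"
  shows "\<exists>m\<in>maximal_seps P. sep_le s m"
proof -
  let ?Q = "{r \<in> P. sep_le s r}"
  have "s \<in> ?Q" using assms(2) by (cases s) auto
  moreover have "finite ?Q" using assms(1) by simp
  moreover have "asymp_on ?Q R" "transp_on ?Q R" if "R = (\<lambda>r s. sep_le r s \<and> r \<noteq> s)" for R
    using that by (auto intro!: asymp_onI transp_onI dest: sep_le_trans sep_le_antisym)
  ultimately obtain m where m: "m \<in> ?Q" "\<And>r. r \<in> ?Q \<Longrightarrow> sep_le m r \<Longrightarrow> r = m"
    using Finite_Set.bex_max_element[of ?Q "\<lambda>r s. sep_le r s \<and> r \<noteq> s"] by blast
  then have "m \<in> maximal_seps P" unfolding maximal_seps_def using sep_le_trans by blast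
  then show ?thesis using m by blast
qed

text \<open>If the join had order below \<open>k\<close>, the profile property would exclude its
  inverse and so put the join into \<open>P\<close>. Lying above both \<open>r\<close> and
  \<open>s\<close>, it would equal both by maximality.\<close>

lemma join_of_maximal_order:
  assumes "universe V U" "profile U k P"
    and "r \<in> maximal_seps P" "s \<in> maximal_seps P" "r \<noteq> s"
  shows "k \<le> int (sep_order (sep_join r s))"
proof (rule ccontr)
  let ?j = "sep_join r s"
  assume "\<not> ?thesis"
  then have less: "int (sep_order ?j) < k" by simp
  have rs: "r \<in> P" "s \<in> P" using assms(3,4) by (auto simp: maximal_seps_def)
  then have "r \<in> U" "s \<in> U" using assms(2) unfolding profile_def seps_below_def by blast+
  then have "?j \<in> U" using assms(1) by (simp add: universe_def)
  then have "?j \<in> seps_below U k" using less by (simp add: seps_below_def)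
  moreover have "sep_inverse ?j \<notin> P" using assms(2) rs less by (auto simp: profile_def)
  ultimately have "?j \<in> P" using assms(2) unfolding profile_def by blast
  then have "?j = r" "?j = s" using assms(3,4) sep_le_join unfolding maximal_seps_def by blast+
  then show False using assms(5) by simp
qed

text \<open>The orders of \<open>r\<close> and \<open>s\<close> add up to less than
  \<open>2k\<close> and the join has order at least \<open>k\<close>, so the meet has order below
  \<open>k\<close>, hence below that of the join.\<close>

lemma maximal_seps_side_diff_pos:
  assumes "finite V" "universe V U" "profile U k P"
    and "r \<in> maximal_seps P" "s \<in> maximal_seps P" "r \<noteq> s"
  shows "0 < (\<Sum>v\<in>separator r. side_diff s v) + (\<Sum>v\<in>separator s. side_diff r v)"
proof -
  have rs: "r \<in> seps_below U k" "s \<in> seps_below U k"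
    using assms(3-5) by (auto simp: maximal_seps_def profile_def)
  have sep: "set_separation V t" if "t \<in> U" for t
    using that assms(2) by (simp add: universe_def)
  have fin: "finite (separator t)" if "t \<in> U" for t
    using sep[OF that] assms(1) by (auto simp: set_separation_def intro: finite_subset)
  have "int (sep_order r) < k" "int (sep_order s) < k" "r \<in> U" "s \<in> U"
    using rs by (auto simp: seps_below_def)
  then show ?thesis
    using join_of_maximal_order[OF assms(2-6)] fin sep
      sep_order_join_plus_meet[of V r s] assms(1) sep_order_join_minus_meet[of r s] by simp
qed

lemma no_nonpositive_combination_of_maximal_seps:
  fixes y :: "'a sep \<Rightarrow> rat"
  assumes "finite V" "universe V U" "profile U k P" "regular P"
    and fin: "finite (maximal_seps P)"
    and nonneg: "\<forall>s\<in>maximal_seps P. 0 \<le> y s"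
    and r: "r \<in> maximal_seps P" "0 < y r"
  shows "\<exists>v\<in>V. 0 < (\<Sum>s\<in>maximal_seps P. y s * of_int (side_diff s v))"
proof (rule ccontr)
  let ?M = "maximal_seps P"
  assume "\<not> ?thesis"
  then have le: "(\<Sum>s\<in>?M. y s * of_int (side_diff s v)) \<le> 0" if "v \<in> V" for v
    using that by (simp add: not_less)
  \<comment> \<open>\<open>D\<close> is not symmetric; only \<open>D s t + D t s\<close> has a known
    sign.\<close>
  define D :: "'a sep \<Rightarrow> 'a sep \<Rightarrow> rat"
    where "D r s = of_int (\<Sum>v\<in>separator r. side_diff s v)" for r s
  have sep: "set_separation V s" if "s \<in> ?M" for s
    using that assms(2,3) by (auto simp: maximal_seps_def profile_def seps_below_def universe_def)
  \<comment> \<open>Separator points lie on both sides, so diagonal terms contribute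
    nothing.\<close>
  have D_refl: "D s s = 0" for s
    by (simp add: D_def side_diff_def)
  have D_pos: "0 < D s t + D t s" if "s \<in> ?M" "t \<in> ?M" "s \<noteq> t" for s t
    using maximal_seps_side_diff_pos[OF assms(1-3) that] unfolding D_def
    by (simp only: of_int_0_less_iff flip: of_int_add)
  have D_nonneg: "0 \<le> y s * y t * (D s t + D t s)" if "s \<in> ?M" "t \<in> ?M" for s t
    using that nonneg D_pos[OF that] by (cases "s = t") (simp_all add: D_refl)
  \<comment> \<open>Swapping sums exhibits the quadratic form as the given combination summed over
    each separator, where it is pointwise nonpositive.\<close>
  have "(\<Sum>s\<in>?M. \<Sum>t\<in>?M. y s * y t * D s t)
      = (\<Sum>s\<in>?M. y s * (\<Sum>v\<in>separator s. \<Sum>t\<in>?M. y t * of_int (side_diff t v)))"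
    by (subst sum.swap[of _ ?M "separator _"])
      (simp add: D_def sum_distrib_left mult.assoc)
  also have "\<dots> \<le> 0"
  proof (rule sum_nonpos)
    fix s assume s: "s \<in> ?M"
    then have "separator s \<subseteq> V" using sep[of s] by (auto simp: set_separation_def)
    then have "(\<Sum>v\<in>separator s. \<Sum>t\<in>?M. y t * of_int (side_diff t v)) \<le> 0"
      by (intro sum_nonpos le) auto
    then show "y s * (\<Sum>v\<in>separator s. \<Sum>t\<in>?M. y t * of_int (side_diff t v)) \<le> 0"
      using nonneg s by (simp add: mult_nonneg_nonpos)
  qed
  finally have *: "(\<Sum>s\<in>?M. \<Sum>t\<in>?M. y s * y t * D s t) \<le> 0" .
  moreover have "(\<Sum>s\<in>?M. \<Sum>t\<in>?M. y s * y t * D t s) = (\<Sum>s\<in>?M. \<Sum>t\<in>?M. y s * y t * D s t)"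
    by (subst sum.swap) (simp add: mult.commute)
  ultimately have sum_le: "(\<Sum>s\<in>?M. \<Sum>t\<in>?M. y s * y t * (D s t + D t s)) \<le> 0"
    by (simp add: distrib_left sum.distrib)
  \<comment> \<open>A second nonzero coefficient would give a positive term in a sum of nonnegative
    terms that is at most 0.\<close>
  have y0: "y t = 0" if "t \<in> ?M" "t \<noteq> r" for t
  proof (rule ccontr)
    assume "y t \<noteq> 0"
    then have "0 < y r * y t * (D r t + D t r)"
      using that nonneg r D_pos[OF r(1) that(1)] by (auto simp: order_less_le)
    then have "0 < (\<Sum>t\<in>?M. y r * y t * (D r t + D t r))"
      using that r D_nonneg fin by - (rule sum_pos2[of ?M t], auto)
    then have "0 < (\<Sum>s\<in>?M. \<Sum>t\<in>?M. y s * y t * (D s t + D t s))"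
      using r D_nonneg fin by - (rule sum_pos2[of ?M r], auto intro: sum_nonneg)
    then show False using sum_le by simp
  qed
  have "side_diff r v \<le> 0" if "v \<in> V" for v
  proof -
    have "(\<Sum>s\<in>?M. y s * of_int (side_diff s v)) = (\<Sum>s\<in>{r}. y s * of_int (side_diff s v))"
      using r fin y0 by (intro sum.mono_neutral_right) auto
    then have "y r * of_int (side_diff r v) \<le> 0" using le[OF that] by simp
    then show ?thesis using r(2) by (simp add: mult_le_0_iff)
  qed
  \<comment> \<open>As the two sides cover \<open>V\<close>, this inclusion forces
    \<open>fst r = V\<close>.\<close>
  then have "\<forall>v\<in>V. v \<in> snd r \<longrightarrow> v \<in> fst r"
    unfolding side_diff_def by fastforce
  then have "cosmall r"
    using sep[OF r(1)] by (cases r) (auto simp: cosmall_def small_def set_separation_def)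
  then show False using assms(4) r(1) by (auto simp: regular_def maximal_seps_def)
qed

section \<open>From weights for the maximal separations to the whole profile\<close>

theorem theorem4:
  fixes V :: "'a set" and U P :: "'a sep set" and k :: int
  assumes "finite V"
    and "universe V U"
    and "profile U k P"
    and "regular P"
  shows "\<exists>w :: 'a \<Rightarrow> nat. \<forall>A B. (A, B) \<in> U \<and> int (sep_order (A, B)) < k \<longrightarrow>
           ((A, B) \<in> P \<longleftrightarrow> (\<Sum>x\<in>A. w x) < (\<Sum>x\<in>B. w x))"
proof -
  have PU: "P \<subseteq> U" using assms(3) by (auto simp: profile_def seps_below_def)
  have UV: "A \<subseteq> V" "B \<subseteq> V" if "(A, B) \<in> U" for A B
    using that assms(2) by (auto simp: universe_def set_separation_def)
  have "P \<subseteq> Pow V \<times> Pow V" using PU UV by fast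
  then have "finite P" using assms(1) by (meson finite_Pow_iff finite_SigmaI finite_subset)
  then have finM: "finite (maximal_seps P)" by (simp add: maximal_seps_def)
  have "\<not> (\<forall>v\<in>V. (\<Sum>s\<in>maximal_seps P. y s * of_int (side_diff s v)) \<le> 0)"
    if "\<forall>s\<in>maximal_seps P. 0 \<le> y s" "\<exists>s\<in>maximal_seps P. 0 < y s" for y :: "'a sep \<Rightarrow> rat"
    using no_nonpositive_combination_of_maximal_seps[OF assms finM that(1)] that(2)
    by (auto simp: not_le)
  then obtain w :: "'a \<Rightarrow> nat"
    where w: "\<And>s. s \<in> maximal_seps P \<Longrightarrow> 0 < (\<Sum>v\<in>V. int (w v) * side_diff s v)"
    using nat_weights_or_nonpositive_combination[OF assms(1) finM, of side_diff] by blast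
  \<comment> \<open>Passing from a maximal \<open>(C, D)\<close> down to \<open>(A, B)\<close>
    shrinks the first side and enlarges the second; as the weights are nonnegative, the strict
    inequality survives.\<close>
  have less: "sum w A < sum w B" if P: "(A, B) \<in> P" for A B
  proof -
    obtain C D where CD: "(C, D) \<in> maximal_seps P" "sep_le (A, B) (C, D)"
      using below_maximal_sep[OF \<open>finite P\<close> P] by auto
    have "(C, D) \<in> U" using CD PU by (auto simp: maximal_seps_def)
    moreover have "(A, B) \<in> U" using P PU by blast
    ultimately have sub: "C \<subseteq> V" "D \<subseteq> V" "A \<subseteq> V" "B \<subseteq> V" using UV by blast+
    have "0 < (\<Sum>v\<in>D. int (w v)) - (\<Sum>v\<in>C. int (w v))"
      using w[OF CD(1)] sub by (simp add: sum_side_diff assms(1) Int_absorb1)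
    then have "int (sum w C) < int (sum w D)" by simp
    then have "sum w C < sum w D" by (simp only: of_nat_less_iff)
    moreover have "finite B" "finite C" using sub assms(1) finite_subset by blast+
    then have "sum w A \<le> sum w C" "sum w D \<le> sum w B"
      using CD(2) by (simp_all add: sum_mono2)
    ultimately show ?thesis by linarith
  qed
  have "(A, B) \<in> P \<longleftrightarrow> sum w A < sum w B" if "(A, B) \<in> U" "int (sep_order (A, B)) < k" for A B
  proof -
    have "(A, B) \<in> seps_below U k" using that by (simp add: seps_below_def)
    moreover have "\<forall>s\<in>seps_below U k. \<exists>!r. r \<in> {s, sep_inverse s} \<and> r \<in> P"
      using assms(3) unfolding profile_def by (elim conjE)
    ultimately have "\<exists>!r. r \<in> {(A, B), sep_inverse (A, B)} \<and> r \<in> P" by (rule bspec[rotated])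
    \<comment> \<open>For the converse: if \<open>(A, B)\<close> is not in \<open>P\<close>, then
      \<open>(B, A)\<close> is, and \<open>less\<close> gives the opposite strict
      inequality.\<close>
    then have "(A, B) \<in> P \<or> (B, A) \<in> P" by auto
    then show ?thesis using less[of A B] less[of B A] by auto
  qed
  then show ?thesis by blast
qed

end
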